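(* Let $(X,Y)$ be a random pair with distribution $P$, with $X$ taking values in a measurable space $S$ and $Y$ in a measurable set $T \subset \mathbb{R}$. Let $\ell : T \times \mathbb{R} \to [0,1]$ be a measurable loss, let $\mathcal{G}$ be a class of measurable functions $g : S \to \mathbb{R}$, and let $g_* \in \mathcal{G}$ be such that $g \mapsto \mathbb{E}[\ell(Y, g(X))]$ achieves its minimum over $\mathcal{G}$ at $g_*$. Write $(\ell \bullet g)(x,y) = \ell(y, g(x))$ and $L(g, g_* ) = \mathbb{E}[(\ell \bullet g)(X,Y) - (\ell \bullet g_* )(X,Y)]$ for $g \in \mathcal{G}$. Let $\xi'_1, \ldots, \xi'_N, \xi_1, \ldots, \xi_n$ be $N + n$ i.i.d. random variables with common distribution $P$. Let $\mathcal{M}$ be a finite set with $|\mathcal{M}| \geq 2$, and let $\{\widehat{g}_m\}_{m \in \mathcal{M}}$ be a collection of estimators with values in $\mathcal{G}$ built from $\xi' = (\xi'_1, \ldots, \xi'_N)$ only. Let $P_n$ be the empirical measure of $\xi_1, \ldots, \xi_n$, and let $\widehat{m}$ be an $\mathcal{M}$-valued random variable minimizing $m \mapsto P_n(\ell \bullet \widehat{g}_m)$ over $\mathcal{M}$ (the hold-out selection procedure). Let $\varphi$ be a convex, invertible (increasing) function from $[0,+\infty)$ onto $[0,+\infty)$ with $\varphi(0) = 0$ and such that $x \mapsto \varphi(x)/x^2$ is nondecreasing, and let $\varphi^*$ be its convex conjugate. Assume that for every $\eta \geq 0$, $$\sup_{g \in \mathcal{G},\ L(g, g_* ) \leq \eta}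 \|\ell \bullet g - \ell \bullet g_*\|_{2,P} \leq \varphi^{-1}(\eta).$$ Then for every $\varepsilon \in (0,1)$, almost surely, $$\mathbb{E}\left[L(\widehat{g}_{\widehat{m}}, g_* ) \,\middle|\, \xi'\right] \leq \frac{1+\varepsilon}{1-\varepsilon} \inf_{m \in \mathcal{M}} L(\widehat{g}_m, g_* ) + \frac{1}{1-\varepsilon} \ln(e|\mathcal{M}|)\left(\frac{4}{\varepsilon}\varphi^*\left(\frac{1}{\sqrt{n}}\right) + \frac{1}{3n}\right).$$
   Context: $P_n f = \frac{1}{n}\sum_{i=1}^n f(\xi_i)$, where each $\xi_i$ is a pair $(X_i, Y_i)$ with values in $S \times T$. $\|f\|_{2,P} = \left(\int f^2 \, dP\right)^{1/2}$. The convex conjugate is $\varphi^*(y) = \sup_{x \geq 0}\,(xy - \varphi(x)) \in [0, +\infty]$ for $y \ge 0$. $L(\widehat{g}_m, g_* )$ denotes the value at $g = \widehat{g}_m$ of the deterministic map $g \mapsto L(g, g_* )$, hence it is a function of $\xi'$; likewise $L(\widehat{g}_{\widehat{m}}, g_* )$ is this map evaluated at the selected estimator. The estimators $\widehat{g}_m$ are assumed jointly measurable in the sample and the point of evaluation, so that these quantities are random variables. *)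

theory Defs
  imports "HOL-Probability.Probability"
begin

definition loss_comp :: "(real \<Rightarrow> real \<Rightarrow> real) \<Rightarrow> ('s \<Rightarrow> real) \<Rightarrow> 's \<times> real \<Rightarrow> real" where
  "loss_comp l g = (\<lambda>(x, y). l y (g x))"

definition excess_risk ::
  "'w measure \<Rightarrow> ('w \<Rightarrow> 's) \<Rightarrow> ('w \<Rightarrow> real) \<Rightarrow> (real \<Rightarrow> real \<Rightarrow> real) \<Rightarrow> ('s \<Rightarrow> real) \<Rightarrow> ('s \<Rightarrow> real) \<Rightarrow> real" where
  "excess_risk \<Omega> X Y l g g' =
     (\<integral>\<omega>. loss_comp l g (X \<omega>, Y \<omega>) - loss_comp l g' (X \<omega>, Y \<omega>) \<partial>\<Omega>)"

definition empirical_mean :: "nat \<Rightarrow> (nat \<Rightarrow> 'z) \<Rightarrow> ('z \<Rightarrow> real) \<Rightarrow> real" where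
  "empirical_mean n z f = (1 / real n) * (\<Sum>i = 1..n. f (z i))"

definition norm2 :: "'z measure \<Rightarrow> ('z \<Rightarrow> real) \<Rightarrow> real" where
  "norm2 P f = sqrt (\<integral>z. (f z)\<^sup>2 \<partial>P)"

definition convex_conjugate :: "(real \<Rightarrow> real) \<Rightarrow> real \<Rightarrow> ereal" where
  "convex_conjugate \<phi> y = (SUP x\<in>{0..}. ereal (x * y - \<phi> x))"

definition sample :: "nat \<Rightarrow> (nat \<Rightarrow> 'w \<Rightarrow> 'z) \<Rightarrow> 'w \<Rightarrow> nat \<Rightarrow> 'z" where
  "sample N \<xi> \<omega> = (\<lambda>i\<in>{1..N}. \<xi> i \<omega>)"

definition sample_space :: "nat \<Rightarrow> 'z measure \<Rightarrow> (nat \<Rightarrow> 'z) measure" where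
  "sample_space N Z = (\<Pi>\<^sub>M i\<in>{1..N}. Z)"

end

theory Submission
  imports Defs
begin

text \<open>
  Fix \<open>k \<in> \<M>\<close> and freeze the training sample \<open>\<xi>'\<close>. As \<open>mhat\<close> minimizes the empirical loss on \<open>\<xi>\<close>, the
  excess risk of the selected estimator exceeds that of \<open>k\<close> by at most \<open>(P - P\<^sub>n) h\<close>, with \<open>h\<close> the
  difference of the two losses. Since \<open>h\<close> has values in \<open>[-1, 1]\<close> and \<open>L\<^sup>2\<close> norm at most
  \<open>\<phi>\<^sup>-\<^sup>1(L m) + \<phi>\<^sup>-\<^sup>1(L k)\<close>, Bernstein's inequality bounds \<open>(P - P\<^sub>n) h\<close>, outside an event of
  probability \<open>exp (- y)\<close>, by \<open>(\<phi>\<^sup>-\<^sup>1(L m) + \<phi>\<^sup>-\<^sup>1(L k)) * sqrt (2 * y / n) + y / (3 * n)\<close>. Young's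
  inequality for \<open>\<phi>\<close> turns this into \<open>\<epsilon> * (L m + L k) + y * A\<close>, where
  \<open>A = 4 / \<epsilon> * \<phi>\<^sup>*(1 / sqrt n) + 1 / (3 * n)\<close>, as soon as \<open>2 * y \<ge> \<epsilon>\<^sup>2\<close>; this is where
  \<open>card \<M> \<ge> 2\<close> enters, through \<open>y \<ge> ln (card \<M>)\<close>. Taking \<open>y = ln (card \<M>) + t / A\<close> and integrating
  the tail over \<open>t \<ge> 0\<close>, the expected positive part of each deviation beyond \<open>A * ln (card \<M>)\<close> is
  at most \<open>A / card \<M>\<close>, so summing over \<open>m \<in> \<M>\<close> costs one more \<open>A\<close>.
\<close>

section \<open>Bernstein's inequality\<close>

text \<open>The terms of the exponential series from order two on are dominated by a geometric
  series of ratio \<open>a / 3\<close>, because \<open>w ^ n \<le> 1\<close> and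
  \<open>fact (n + 2) \<ge> 2 * 3 ^ n\<close>. Keeping the factor \<open>w\<^sup>2\<close> apart
  lets the second moment appear on integration.\<close>

lemma exp_mult_le_bernstein:
  fixes a w :: real
  assumes a: "0 \<le> a" "a < 3" and w: "\<bar>w\<bar> \<le> 1"
  shows "exp (a * w) \<le> 1 + a * w + w\<^sup>2 * (a\<^sup>2 / (2 * (1 - a / 3)))"
proof -
  have fact_ge: "2 * 3 ^ n \<le> (fact (n + 2) :: real)" for n
  proof (induction n)
    case (Suc n)
    have "2 * 3 ^ Suc n = (3::real) * (2 * 3 ^ n)" by simp
    also have "\<dots> \<le> (real n + 3) * fact (n + 2)"
      by (intro mult_mono Suc) auto
    also have "\<dots> = fact (Suc n + 2)"
      by (simp add: algebra_simps)
    finally show ?case .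
  qed simp
  have geom: "(\<lambda>n. w\<^sup>2 * a\<^sup>2 / 2 * (a / 3) ^ n) sums (w\<^sup>2 * a\<^sup>2 / 2 * (1 / (1 - a / 3)))"
    by (intro sums_mult geometric_sums) (use a in auto)
  have "(\<Sum>n. inverse (fact (n + 2)) * (a * w) ^ (n + 2)) \<le> (\<Sum>n. w\<^sup>2 * a\<^sup>2 / 2 * (a / 3) ^ n)"
  proof (rule suminf_le)
    show "summable (\<lambda>n. inverse (fact (n + 2)) * (a * w) ^ (n + 2))"
      by (rule summable_exp [THEN summable_ignore_initial_segment])
    show "summable (\<lambda>n. w\<^sup>2 * a\<^sup>2 / 2 * (a / 3) ^ n)"
      by (rule sums_summable[OF geom])
    fix n
    have "w ^ n \<le> 1"
      using w by (metis abs_ge_self order_trans power_abs power_le_one abs_ge_zero)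
    then have "a ^ (n + 2) * w\<^sup>2 * w ^ n \<le> a ^ (n + 2) * w\<^sup>2 * 1"
      using a by (intro mult_left_mono) auto
    then have "(a * w) ^ (n + 2) \<le> a ^ (n + 2) * w\<^sup>2"
      by (simp add: power_mult_distrib power_add power2_eq_square ac_simps)
    then have "inverse (fact (n + 2)) * (a * w) ^ (n + 2) \<le> inverse (fact (n + 2)) * (a ^ (n + 2) * w\<^sup>2)"
      by (intro mult_left_mono) auto
    also have "\<dots> \<le> inverse (2 * 3 ^ n) * (a ^ (n + 2) * w\<^sup>2)"
      using a by (intro mult_right_mono le_imp_inverse_le fact_ge) auto
    also have "\<dots> = w\<^sup>2 * a\<^sup>2 / 2 * (a / 3) ^ n"
      by (simp add: field_simps power_add power2_eq_square)
    finally show "inverse (fact (n + 2)) * (a * w) ^ (n + 2) \<le> w\<^sup>2 * a\<^sup>2 / 2 * (a / 3) ^ n" .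
  qed
  also have "\<dots> = w\<^sup>2 * (a\<^sup>2 / (2 * (1 - a / 3)))"
    using sums_unique[OF geom] by simp
  finally show ?thesis
    unfolding exp_first_two_terms[of "a * w"] real_scaleR_def by linarith
qed

text \<open>Integrating the pointwise bound gives at most
  \<open>1 + (a * expectation V + v * q)\<close>, and \<open>1 + x \<le> exp x\<close> followed by
  division by \<open>exp (a * expectation V)\<close> leaves \<open>exp (v * q)\<close>. The
  nonnegative integral is the form in which Chernoff's bound and the product formula for independent
  variables are applied.\<close>

lemma (in prob_space) centered_mgf_le:
  assumes [measurable]: "V \<in> borel_measurable M"
    and bdd: "\<And>\<omega>. \<omega> \<in> space M \<Longrightarrow> \<bar>V \<omega>\<bar> \<le> 1"
    and v: "expectation (\<lambda>\<omega>. (V \<omega>)\<^sup>2) \<le> v"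
    and a: "0 \<le> a" "a < 3"
  shows "(\<integral>\<^sup>+\<omega>. ennreal (exp (a * (V \<omega> - expectation V))) \<partial>M) \<le> ennreal (exp (v * (a\<^sup>2 / (2 * (1 - a / 3)))))"
proof -
  define q where "q = a\<^sup>2 / (2 * (1 - a / 3))"
  have q: "0 \<le> q" using a by (auto simp: q_def)
  have iV: "integrable M V"
    using bdd by (intro integrable_const_bound[of _ 1]) auto
  have iV2: "integrable M (\<lambda>\<omega>. (V \<omega>)\<^sup>2)"
    using bdd by (intro integrable_const_bound[of _ 1]) (auto simp: abs_square_le_1)
  have iE: "integrable M (\<lambda>\<omega>. exp (a * V \<omega>))"
  proof (intro integrable_const_bound[of _ "exp a"])
    show "AE \<omega> in M. norm (exp (a * V \<omega>)) \<le> exp a"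
    proof (rule AE_I2)
      fix \<omega> assume "\<omega> \<in> space M"
      from bdd[OF this] have "V \<omega> \<le> 1" by auto
      then show "norm (exp (a * V \<omega>)) \<le> exp a"
        using a by (simp add: mult_right_le_one_le mult_left_le)
    qed
  qed auto
  have "expectation (\<lambda>\<omega>. exp (a * V \<omega>)) \<le> expectation (\<lambda>\<omega>. 1 + a * V \<omega> + (V \<omega>)\<^sup>2 * q)"
    unfolding q_def
    by (intro integral_mono iE Bochner_Integration.integrable_add integrable_mult_right integrable_mult_left iV iV2
          exp_mult_le_bernstein a bdd) auto
  also have "\<dots> = 1 + a * expectation V + expectation (\<lambda>\<omega>. (V \<omega>)\<^sup>2) * q"
    using iV iV2 by (simp add: prob_space)
  also have "\<dots> \<le> 1 + (a * expectation V + v * q)"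
    using mult_right_mono[OF v q] by simp
  also have "\<dots> \<le> exp (a * expectation V + v * q)"
    by (rule exp_ge_add_one_self)
  finally have *: "expectation (\<lambda>\<omega>. exp (a * V \<omega>)) \<le> exp (a * expectation V + v * q)" .
  have eq: "exp (a * (V \<omega> - expectation V)) = exp (a * V \<omega>) * exp (- (a * expectation V))" for \<omega>
    by (simp add: exp_add[symmetric] algebra_simps)
  have "(\<integral>\<^sup>+\<omega>. ennreal (exp (a * (V \<omega> - expectation V))) \<partial>M)
      = ennreal (expectation (\<lambda>\<omega>. exp (a * V \<omega>) * exp (- (a * expectation V))))"
    unfolding eq using iE by (intro nn_integral_eq_integral) auto
  also have "expectation (\<lambda>\<omega>. exp (a * V \<omega>) * exp (- (a * expectation V)))
     = expectation (\<lambda>\<omega>. exp (a * V \<omega>)) * exp (- (a * expectation V))" by simp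
  also have "\<dots> \<le> exp (a * expectation V + v * q) * exp (- (a * expectation V))"
    by (intro mult_right_mono *) auto
  also have "\<dots> = exp (v * q)" by (simp add: exp_add[symmetric])
  finally show ?thesis by (simp add: q_def ennreal_leI)
qed

text \<open>Chernoff's bound at the exponent \<open>a\<close> with \<open>1 / a = 1 / u + 1 / 3\<close>; then
  \<open>a / (1 - a / 3) = u\<close>, and the exponent collapses to \<open>- y\<close>.\<close>

lemma (in prob_space) bernstein_tail_param:
  fixes V :: "'i \<Rightarrow> 'a \<Rightarrow> real" and v u y :: real
  assumes fin: "finite I"
    and indep: "indep_vars (\<lambda>_. borel) V I"
    and bdd: "\<And>i \<omega>. i \<in> I \<Longrightarrow> \<omega> \<in> space M \<Longrightarrow> \<bar>V i \<omega>\<bar> \<le> 1"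
    and v: "\<And>i. i \<in> I \<Longrightarrow> expectation (\<lambda>\<omega>. (V i \<omega>)\<^sup>2) \<le> v"
    and u: "u > 0"
  shows "prob {\<omega>\<in>space M. (\<Sum>i\<in>I. V i \<omega> - expectation (V i)) \<ge> card I * v * u / 2 + y / u + y / 3} \<le> exp (- y)"
proof -
  define a where "a = 3 * u / (3 + u)"
  define t where "t = card I * v * u / 2 + y / u + y / 3"
  define q where "q = a\<^sup>2 / (2 * (1 - a / 3))"
  have a: "0 < a" "a < 3" using u by (auto simp: a_def field_simps)
  have q: "q = a * u / 2"
    using u by (simp add: q_def a_def power2_eq_square divide_simps) (simp add: algebra_simps)
  have V[measurable]: "i \<in> I \<Longrightarrow> V i \<in> borel_measurable M" for i
    using indep by (auto simp: indep_vars_def)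
  define S where "S \<omega> = (\<Sum>i\<in>I. V i \<omega> - expectation (V i))" for \<omega>
  have [measurable]: "S \<in> borel_measurable M"
    unfolding S_def by measurable
  have "ennreal (prob {\<omega>\<in>space M. S \<omega> \<ge> t}) = emeasure M {\<omega>\<in>space M. S \<omega> \<ge> t}"
    by (simp add: emeasure_eq_measure)
  also have "\<dots> \<le> ennreal (exp (- a * t)) * (\<integral>\<^sup>+\<omega>\<in>space M. ennreal (exp (a * S \<omega>)) \<partial>M)"
    by (intro Chernoff_ineq_nn_integral_ge a) auto
  also have "(\<integral>\<^sup>+\<omega>\<in>space M. ennreal (exp (a * S \<omega>)) \<partial>M)
      = (\<integral>\<^sup>+\<omega>. (\<Prod>i\<in>I. ennreal (exp (a * (V i \<omega> - expectation (V i))))) \<partial>M)"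
    by (intro nn_integral_cong) (simp add: S_def sum_distrib_left exp_sum fin prod_ennreal)
  also have "\<dots> = (\<Prod>i\<in>I. \<integral>\<^sup>+\<omega>. ennreal (exp (a * (V i \<omega> - expectation (V i)))) \<partial>M)"
    by (intro indep_vars_nn_integral fin indep_vars_compose2[OF indep]) auto
  also have "\<dots> \<le> (\<Prod>i\<in>I. ennreal (exp (v * q)))"
    unfolding q_def using a v bdd V by (intro prod_mono_ennreal centered_mgf_le) auto
  also have "ennreal (exp (- a * t)) * \<dots> = ennreal (exp (- a * t) * exp (v * q) ^ card I)"
    by (simp add: ennreal_power ennreal_mult)
  also have "exp (- a * t) * exp (v * q) ^ card I = exp (- a * t + card I * (v * q))"
    by (simp only: exp_add exp_of_nat_mult)
  also have "- a * t + card I * (v * q) = - (a * (1 / u + 1 / 3)) * y"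
    by (simp add: q t_def algebra_simps)
  also have "a * (1 / u + 1 / 3) = 1"
    using u by (simp add: a_def divide_simps)
  finally show ?thesis
    by (simp add: mult_left_mono S_def t_def)
qed

text \<open>The parameter is \<open>u = r / s\<close> with \<open>r = sqrt (2 * y / card I)\<close>.
  It makes the terms \<open>card I * s\<^sup>2 * u / 2\<close> and \<open>y / u\<close> equal, hence
  their sum minimal, namely \<open>s * sqrt (2 * y * card I)\<close>.\<close>

lemma (in prob_space) bernstein_tail:
  fixes V :: "'i \<Rightarrow> 'a \<Rightarrow> real" and s y :: real
  assumes fin: "finite I"
    and indep: "indep_vars (\<lambda>_. borel) V I"
    and bdd: "\<And>i \<omega>. i \<in> I \<Longrightarrow> \<omega> \<in> space M \<Longrightarrow> \<bar>V i \<omega>\<bar> \<le> 1"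
    and v: "\<And>i. i \<in> I \<Longrightarrow> expectation (\<lambda>\<omega>. (V i \<omega>)\<^sup>2) \<le> s\<^sup>2"
    and s: "s \<ge> 0" and y: "y > 0"
  shows "prob {\<omega>\<in>space M. (\<Sum>i\<in>I. V i \<omega> - expectation (V i)) > s * sqrt (2 * y * card I) + y / 3} \<le> exp (- y)"
proof -
  have V[measurable]: "i \<in> I \<Longrightarrow> V i \<in> borel_measurable M" for i
    using indep by (auto simp: indep_vars_def)
  \<comment> \<open>The optimal parameter requires \<open>s\<close> and \<open>card I\<close> to be
    nonzero. Otherwise every \<open>V i\<close> vanishes almost everywhere or there is no index at
    all, so the centered sum is almost surely zero while the threshold is
    \<open>y / 3 > 0\<close>.\<close>
  consider "s = 0 \<or> card I = 0" | "s > 0" "card I > 0" using s by fastforce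
  then show ?thesis
  proof cases
    case 1
    have "AE \<omega> in M. V i \<omega> = expectation (V i)" if i: "i \<in> I" for i
    proof -
      have "s = 0" using 1 i fin by auto
      then have "expectation (\<lambda>\<omega>. (V i \<omega>)\<^sup>2) = 0"
        using v[OF i] by (intro antisym) auto
      moreover have "integrable M (\<lambda>\<omega>. (V i \<omega>)\<^sup>2)"
        using bdd[OF i] V[OF i] by (intro integrable_const_bound[of _ 1]) (auto simp: abs_square_le_1)
      ultimately have *: "AE \<omega> in M. V i \<omega> = 0"
        using integral_nonneg_eq_0_iff_AE[of M "\<lambda>\<omega>. (V i \<omega>)\<^sup>2"] by auto
      then have "expectation (V i) = expectation (\<lambda>_. 0)"
        using V[OF i] by (intro integral_cong_AE) auto
      with * show ?thesis by auto
    qed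
    then have "AE \<omega> in M. \<forall>i\<in>I. V i \<omega> = expectation (V i)"
      by (intro AE_finite_allI fin)
    then have "AE \<omega> in M. \<not> (\<Sum>i\<in>I. V i \<omega> - expectation (V i)) > s * sqrt (2 * y * card I) + y / 3"
    proof eventually_elim
      case (elim \<omega>)
      then show ?case using 1 y by auto
    qed
    then have "prob {\<omega>\<in>space M. (\<Sum>i\<in>I. V i \<omega> - expectation (V i)) > s * sqrt (2 * y * card I) + y / 3} = 0"
      by (subst prob_eq_0) auto
    then show ?thesis by simp
  next
    case 2
    define r where "r = sqrt (2 * y / card I)"
    have r: "r > 0" using 2 y by (auto simp: r_def)
    have r2: "r * r = 2 * y / card I" using 2 y by (simp add: r_def)
    have rr: "sqrt (2 * y * card I) = r * card I"
      using 2 y by (simp add: r_def real_sqrt_mult real_sqrt_divide)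
        (metis of_nat_0_le_iff real_div_sqrt mult.commute times_divide_eq_right)
    have y: "y = r * r * card I / 2" using 2 by (simp add: r2)
    have y': "y / (r / s) = s * (r * card I) / 2"
      unfolding y using r by simp
    have "card I * s\<^sup>2 * (r / s) / 2 + y / (r / s) + y / 3 = s * sqrt (2 * y * card I) + y / 3"
      unfolding y' rr using 2 by (simp add: power2_eq_square)
    then have "prob {\<omega>\<in>space M. (\<Sum>i\<in>I. V i \<omega> - expectation (V i)) \<ge> s * sqrt (2 * y * card I) + y / 3} \<le> exp (- y)"
      using bernstein_tail_param[OF fin indep bdd v, of "r / s" y] r 2 by simp
    moreover have "prob {\<omega>\<in>space M. (\<Sum>i\<in>I. V i \<omega> - expectation (V i)) > s * sqrt (2 * y * card I) + y / 3}
       \<le> prob {\<omega>\<in>space M. (\<Sum>i\<in>I. V i \<omega> - expectation (V i)) \<ge> s * sqrt (2 * y * card I) + y / 3}"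
      by (intro finite_measure_mono) auto
    ultimately show ?thesis by simp
  qed
qed

section \<open>Tail integration and the triangle inequality in \<open>L\<^sup>2\<close>\<close>

text \<open>The positive part of \<open>Q\<close> is the length of the set of \<open>t\<close> with
  \<open>0 \<le> t < Q\<close>. Fubini turns its expectation into the integral of the tail
  probabilities over \<open>t \<ge> 0\<close>, and the exponential majorant integrates to
  \<open>K * A\<close>.\<close>

lemma (in prob_space) expectation_pos_part_le_of_exp_tail:
  fixes Q :: "'a \<Rightarrow> real"
  assumes Q: "integrable M Q"
    and A: "A > 0" and K: "K \<ge> 0"
    and tail: "\<And>t. t \<ge> 0 \<Longrightarrow> prob {\<omega>\<in>space M. Q \<omega> > t} \<le> K * exp (- t / A)"
  shows "expectation (\<lambda>\<omega>. max 0 (Q \<omega>)) \<le> K * A"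
proof -
  have [measurable]: "Q \<in> borel_measurable M" using Q by auto
  have layer: "ennreal (max 0 x) = (\<integral>\<^sup>+t. indicator {0..} t * indicator {..<x} t \<partial>lborel)" for x :: real
  proof -
    have "(\<integral>\<^sup>+t. indicator {0..} t * indicator {..<x} t \<partial>lborel) = (\<integral>\<^sup>+t. indicator {0..<x} t \<partial>lborel)"
      by (intro nn_integral_cong) (auto simp: indicator_def)
    also have "\<dots> = ennreal (max 0 x)"
      by (cases "x \<ge> 0") auto
    finally show ?thesis ..
  qed
  interpret L: pair_sigma_finite M "lborel :: real measure" ..
  have "(\<integral>\<^sup>+\<omega>. ennreal (max 0 (Q \<omega>)) \<partial>M) = (\<integral>\<^sup>+\<omega>. \<integral>\<^sup>+t. indicator {0..} t * indicator {..<Q \<omega>} t \<partial>lborel \<partial>M)"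
    by (intro nn_integral_cong layer)
  also have "\<dots> = (\<integral>\<^sup>+t. \<integral>\<^sup>+\<omega>. indicator {0..} t * indicator {..<Q \<omega>} t \<partial>M \<partial>lborel)"
    by (rule L.Fubini'[symmetric]) (simp add: indicator_def)
  also have "\<dots> \<le> (\<integral>\<^sup>+t. ennreal (K * exp (- t / A)) * indicator {0..} t \<partial>lborel)"
  proof (rule nn_integral_mono)
    fix t :: real
    have "(\<integral>\<^sup>+\<omega>. indicator {0..} t * indicator {..<Q \<omega>} t \<partial>M)
       = indicator {0..} t * (\<integral>\<^sup>+\<omega>. indicator {\<omega>\<in>space M. Q \<omega> > t} \<omega> \<partial>M)"
      by (subst nn_integral_cmult[symmetric]) (auto intro!: nn_integral_cong simp: indicator_def)
    also have "\<dots> = indicator {0..} t * ennreal (prob {\<omega>\<in>space M. Q \<omega> > t})"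
      by (simp add: emeasure_eq_measure)
    also have "\<dots> \<le> ennreal (K * exp (- t / A)) * indicator {0..} t"
      using tail[of t] by (auto simp: indicator_def intro!: ennreal_leI)
    finally show "(\<integral>\<^sup>+\<omega>. indicator {0..} t * indicator {..<Q \<omega>} t \<partial>M) \<le> ennreal (K * exp (- t / A)) * indicator {0..} t" .
  qed
  also have "\<dots> = ennreal (0 - (- K * A * exp (- 0 / A)))"
  proof (rule nn_integral_FTC_atLeast)
    show "((\<lambda>t. - K * A * exp (- t / A)) \<longlongrightarrow> 0) at_top"
      using A by real_asymp
    fix x :: real
    show "DERIV (\<lambda>t. - K * A * exp (- t / A)) x :> K * exp (- x / A)"
      using A by (auto intro!: derivative_eq_intros)
  qed (use K in auto)
  finally have "(\<integral>\<^sup>+\<omega>. ennreal (max 0 (Q \<omega>)) \<partial>M) \<le> ennreal (K * A)" by simp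
  moreover have "(\<integral>\<^sup>+\<omega>. ennreal (max 0 (Q \<omega>)) \<partial>M) = ennreal (expectation (\<lambda>\<omega>. max 0 (Q \<omega>)))"
    using Q by (intro nn_integral_eq_integral) auto
  ultimately show ?thesis
    using A K by simp
qed

text \<open>Minkowski's inequality from a weighted bound on \<open>(x - z)\<^sup>2\<close>, whose
  gap is a multiple of a perfect square. The weights are such that the integrated right-hand side is
  at most \<open>(a + b)\<^sup>2\<close>.\<close>

lemma norm2_diff_le:
  fixes f g :: "'a \<Rightarrow> real"
  assumes f: "integrable M (\<lambda>x. (f x)\<^sup>2)" and g: "integrable M (\<lambda>x. (g x)\<^sup>2)"
  shows "norm2 M (\<lambda>x. f x - g x) \<le> norm2 M f + norm2 M g"
proof (rule field_le_epsilon)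
  fix e :: real assume e: "e > 0"
  \<comment> \<open>The margin \<open>e / 2\<close> keeps both numbers positive, so the ratios
    \<open>b / a\<close> and \<open>a / b\<close> make sense even if a norm vanishes.\<close>
  define a b where "a = norm2 M f + e / 2" and "b = norm2 M g + e / 2"
  have n: "norm2 M f \<ge> 0" "norm2 M g \<ge> 0" by (auto simp: norm2_def)
  have a: "a > 0" and b: "b > 0" using e n by (auto simp: a_def b_def)
  have fa: "(\<integral>x. (f x)\<^sup>2 \<partial>M) \<le> a\<^sup>2"
    using n e by (intro sqrt_le_D) (simp add: a_def norm2_def)
  have gb: "(\<integral>x. (g x)\<^sup>2 \<partial>M) \<le> b\<^sup>2"
    using n e by (intro sqrt_le_D) (simp add: b_def norm2_def)
  have pt: "(x - z)\<^sup>2 \<le> (1 + b / a) * x\<^sup>2 + (1 + a / b) * z\<^sup>2" for x z :: real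
  proof -
    have "0 \<le> (b * x + a * z)\<^sup>2 / (a * b)" using a b by simp
    also have "\<dots> = (1 + b / a) * x\<^sup>2 + (1 + a / b) * z\<^sup>2 - (x - z)\<^sup>2"
      using a b by (simp add: divide_simps power2_eq_square) (simp add: algebra_simps)
    finally show ?thesis by simp
  qed
  have "(\<integral>x. (f x - g x)\<^sup>2 \<partial>M) \<le> (\<integral>x. (1 + b / a) * (f x)\<^sup>2 + (1 + a / b) * (g x)\<^sup>2 \<partial>M)"
    using a b by (intro Bochner_Integration.integral_mono' pt Bochner_Integration.integrable_add integrable_mult_right f g) auto
  also have "\<dots> = (1 + b / a) * (\<integral>x. (f x)\<^sup>2 \<partial>M) + (1 + a / b) * (\<integral>x. (g x)\<^sup>2 \<partial>M)"
    using f g by simp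
  also have "\<dots> \<le> (1 + b / a) * a\<^sup>2 + (1 + a / b) * b\<^sup>2"
    using a b by (intro add_mono mult_left_mono fa gb) auto
  also have "\<dots> = (a + b)\<^sup>2"
    using a b by (simp add: field_simps power2_eq_square)
  finally have "norm2 M (\<lambda>x. f x - g x) \<le> a + b"
    unfolding norm2_def using a b by (intro real_le_lsqrt) auto
  then show "norm2 M (\<lambda>x. f x - g x) \<le> norm2 M f + norm2 M g + e"
    by (simp add: a_def b_def)
qed

section \<open>Conditioning on an independent variable\<close>

lemma sets_vimage_algebra_measurable:
  assumes "S \<in> measurable M E"
  shows "sets (vimage_algebra (space M) S E) = {S -` C \<inter> space M | C. C \<in> sets E}"
  using measurable_space[OF assms] by (intro sets_vimage_algebra2) auto

lemma subalgebra_vimage_algebra: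
  assumes "S \<in> measurable M E"
  shows "subalgebra M (vimage_algebra (space M) S E)"
  unfolding subalgebra_def sets_vimage_algebra_measurable[OF assms]
  using measurable_sets[OF assms] by auto

text \<open>By independence the joint law of \<open>S\<close> and \<open>T\<close> is a product, so
  Fubini integrates out \<open>T\<close> and leaves a function \<open>h\<close> of \<open>S\<close>.
  Its integrals over the events generated by \<open>S\<close> agree with those of
  \<open>W (S, T)\<close>, which characterizes the conditional expectation.\<close>

lemma (in prob_space) real_cond_exp_indep_var:
  fixes W :: "'b \<times> 'b \<Rightarrow> real"
  assumes indep: "indep_var E S F T"
    and W[measurable]: "W \<in> borel_measurable (E \<Otimes>\<^sub>M F)"
    and int: "integrable M (\<lambda>\<omega>. W (S \<omega>, T \<omega>))"
  shows "AE \<omega> in M. real_cond_exp M (vimage_algebra (space M) S E) (\<lambda>\<omega>. W (S \<omega>, T \<omega>)) \<omega>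
           = (\<integral>\<omega>'. W (S \<omega>, T \<omega>') \<partial>M)"
proof -
  have S[measurable]: "S \<in> measurable M E" and T[measurable]: "T \<in> measurable M F"
    and joint: "distr M E S \<Otimes>\<^sub>M distr M F T = distr M (E \<Otimes>\<^sub>M F) (\<lambda>x. (S x, T x))"
    using indep by (auto simp: indep_var_distribution_eq)
  define G where "G = vimage_algebra (space M) S E"
  have sub: "subalgebra M G"
    unfolding G_def by (rule subalgebra_vimage_algebra) fact
  interpret G: finite_measure_subalgebra M G
    by standard (rule sub)
  have SG[measurable]: "S \<in> measurable G E"
    unfolding G_def using measurable_space[OF S] by (intro measurable_vimage_algebra1) auto
  interpret \<mu>: prob_space "distr M E S" by (rule prob_space_distr) simp
  interpret \<nu>: prob_space "distr M F T" by (rule prob_space_distr) simp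
  interpret pair_sigma_finite "distr M E S" "distr M F T" ..
  have setsjoint[measurable_cong]: "sets (distr M E S \<Otimes>\<^sub>M distr M F T) = sets (E \<Otimes>\<^sub>M F)"
    by (rule sets_pair_measure_cong) auto
  have intW: "integrable (distr M E S \<Otimes>\<^sub>M distr M F T) W"
    unfolding joint using int by (subst integrable_distr_eq) auto
  define h where "h z = (\<integral>x. W (z, x) \<partial>distr M F T)" for z
  have h_eq: "h z = (\<integral>\<omega>'. W (z, T \<omega>') \<partial>M)" if "z \<in> space E" for z
    unfolding h_def using that by (intro integral_distr) auto
  have h[measurable]: "h \<in> borel_measurable E"
    unfolding h_def by measurable
  have inth: "integrable M (\<lambda>\<omega>. h (S \<omega>))"
  proof -
    have "integrable (distr M E S) h"
      unfolding h_def by (rule integrable_fst'[OF intW])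
    then show ?thesis by (subst (asm) integrable_distr_eq) auto
  qed
  have "AE \<omega> in M. real_cond_exp M G (\<lambda>\<omega>. W (S \<omega>, T \<omega>)) \<omega> = h (S \<omega>)"
  proof (rule G.real_cond_exp_charact)
    \<comment> \<open>An event of the generated sigma-algebra is a preimage under \<open>S\<close>,
      so its indicator depends on the first coordinate only and comes out of the inner
      integral.\<close>
    fix A assume "A \<in> sets G"
    then obtain C where C[measurable]: "C \<in> sets E" and A: "A = S -` C \<inter> space M"
      unfolding G_def sets_vimage_algebra_measurable[OF S] by auto
    have ind: "indicator A \<omega> = (indicator C (S \<omega>) :: real)" if "\<omega> \<in> space M" for \<omega>
      using that by (auto simp: A indicator_def)
    have "(\<integral>\<omega>\<in>A. W (S \<omega>, T \<omega>) \<partial>M) = (\<integral>\<omega>. indicator C (fst (S \<omega>, T \<omega>)) * W (S \<omega>, T \<omega>) \<partial>M)"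
      unfolding set_lebesgue_integral_def
      by (intro Bochner_Integration.integral_cong) (auto simp: ind)
    also have "\<dots> = (\<integral>p. indicator C (fst p) * W p \<partial>(distr M E S \<Otimes>\<^sub>M distr M F T))"
      unfolding joint by (intro integral_distr[symmetric]) measurable
    also have "\<dots> = (\<integral>z. \<integral>x. indicator C (fst (z, x)) * W (z, x) \<partial>distr M F T \<partial>distr M E S)"
    proof (rule integral_fst'[symmetric])
      show "integrable (distr M E S \<Otimes>\<^sub>M distr M F T) (\<lambda>p. indicator C (fst p) * W p)"
        by (rule Bochner_Integration.integrable_bound[OF intW]) (auto simp: indicator_def)
    qed
    also have "\<dots> = (\<integral>z. indicator C z * h z \<partial>distr M E S)"
      by (simp add: h_def)
    also have "\<dots> = (\<integral>\<omega>. indicator C (S \<omega>) * h (S \<omega>) \<partial>M)"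
      by (intro integral_distr) measurable
    also have "\<dots> = (\<integral>\<omega>\<in>A. h (S \<omega>) \<partial>M)"
      unfolding set_lebesgue_integral_def
      by (intro Bochner_Integration.integral_cong) (auto simp: ind)
    finally show "(\<integral>\<omega>\<in>A. W (S \<omega>, T \<omega>) \<partial>M) = (\<integral>\<omega>\<in>A. h (S \<omega>) \<partial>M)" .
  qed (use int inth in auto)
  then have "AE \<omega> in M. \<omega> \<in> space M \<longrightarrow> real_cond_exp M G (\<lambda>\<omega>. W (S \<omega>, T \<omega>)) \<omega> = h (S \<omega>)"
    by auto
  then show ?thesis
    unfolding G_def[symmetric] using AE_space
    by eventually_elim (simp add: h_eq measurable_space[OF S])
qed

lemma (in prob_space) real_cond_exp_le_of_indep_var:
  fixes W :: "'b \<times> 'b \<Rightarrow> real"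
  assumes indep: "indep_var E S F T"
    and W[measurable]: "W \<in> borel_measurable (E \<Otimes>\<^sub>M F)"
    and intW: "integrable M (\<lambda>\<omega>. W (S \<omega>, T \<omega>))"
    and W_le: "\<And>z. z \<in> space E \<Longrightarrow> (\<integral>\<omega>. W (z, T \<omega>) \<partial>M) \<le> K"
    and R[measurable]: "R \<in> borel_measurable E"
    and intR: "integrable M (\<lambda>\<omega>. R (S \<omega>))"
    and intf: "integrable M f"
    and f_le: "AE \<omega> in M. f \<omega> \<le> R (S \<omega>) + W (S \<omega>, T \<omega>)"
  shows "AE \<omega> in M. real_cond_exp M (vimage_algebra (space M) S E) f \<omega> \<le> R (S \<omega>) + K"
proof -
  have S[measurable]: "S \<in> measurable M E"
    using indep by (auto simp: indep_var_distribution_eq)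
  define G where "G = vimage_algebra (space M) S E"
  have sub: "subalgebra M G"
    unfolding G_def by (rule subalgebra_vimage_algebra) fact
  interpret G: finite_measure_subalgebra M G
    by standard (rule sub)
  have SG[measurable]: "S \<in> measurable G E"
    unfolding G_def using measurable_space[OF S] by (intro measurable_vimage_algebra1) auto
  have "AE \<omega> in M. real_cond_exp M G f \<omega> \<le> real_cond_exp M G (\<lambda>\<omega>. R (S \<omega>) + W (S \<omega>, T \<omega>)) \<omega>"
    using f_le intf intR intW by (intro G.real_cond_exp_mono) auto
  moreover have "AE \<omega> in M. real_cond_exp M G (\<lambda>\<omega>. R (S \<omega>) + W (S \<omega>, T \<omega>)) \<omega>
      = real_cond_exp M G (\<lambda>\<omega>. R (S \<omega>)) \<omega> + real_cond_exp M G (\<lambda>\<omega>. W (S \<omega>, T \<omega>)) \<omega>"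
    using intR intW by (rule G.real_cond_exp_add)
  moreover have "AE \<omega> in M. real_cond_exp M G (\<lambda>\<omega>. R (S \<omega>)) \<omega> = R (S \<omega>)"
    using intR by (rule G.real_cond_exp_F_meas) measurable
  moreover have "AE \<omega> in M. real_cond_exp M G (\<lambda>\<omega>. W (S \<omega>, T \<omega>)) \<omega> = (\<integral>\<omega>'. W (S \<omega>, T \<omega>') \<partial>M)"
    unfolding G_def by (rule real_cond_exp_indep_var[OF indep W intW])
  moreover have "AE \<omega> in M. (\<integral>\<omega>'. W (S \<omega>, T \<omega>') \<partial>M) \<le> K"
    using measurable_space[OF S] by (intro AE_I2 W_le)
  ultimately show ?thesis
    unfolding G_def[symmetric] by eventually_elim simp
qed

section \<open>Hold-out selection\<close>

text \<open>Scaling by \<open>a \<ge> 1\<close> costs only a factor \<open>a\<^sup>2\<close> in the conjugate: \<open>a\<^sup>2 * \<phi> (r / a) \<le> \<phi> r\<close>.\<close>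

lemma scaled_young_ineq:
  fixes \<phi> :: "real \<Rightarrow> real"
  assumes mono: "mono_on {0<..} (\<lambda>x. \<phi> x / x\<^sup>2)"
    and zero: "\<phi> 0 = 0"
    and conj: "\<And>x. x \<ge> 0 \<Longrightarrow> x * b - \<phi> x \<le> p"
    and a: "a \<ge> 1" and r: "r \<ge> 0"
  shows "r * a * b \<le> \<phi> r + a\<^sup>2 * p"
proof (cases "r = 0")
  case True
  then show ?thesis using conj[of 0] zero by simp
next
  case False
  then have r: "r > 0" using r by simp
  have "r / a \<le> r" using a r by (simp add: field_simps)
  then have "\<phi> (r / a) / (r / a)\<^sup>2 \<le> \<phi> r / r\<^sup>2"
    using a r by (intro mono_onD[OF mono]) auto
  then have "a\<^sup>2 * \<phi> (r / a) \<le> \<phi> r"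
    using a r by (simp add: field_simps)
  moreover have "a\<^sup>2 * (r / a * b - \<phi> (r / a)) \<le> a\<^sup>2 * p"
    using a r by (intro mult_left_mono conj) auto
  then have "a\<^sup>2 * (r / a * b) - a\<^sup>2 * \<phi> (r / a) \<le> a\<^sup>2 * p"
    by (simp only: right_diff_distrib)
  moreover have "a\<^sup>2 * (r / a * b) = r * a * b"
    using a by (simp add: power2_eq_square)
  ultimately show ?thesis by simp
qed

text \<open>The estimate for a frozen training sample: \<open>f\<close> and \<open>g\<close> stand
  for the excess losses of a candidate and of its competitor, \<open>rf\<close> and
  \<open>rg\<close> for the values of the inverse of \<open>\<phi>\<close> at their risks, and
  \<open>c\<close> for the number of estimators. The tail beyond \<open>A * ln c\<close> is at most
  \<open>exp (- t / A) / c\<close>, which integrates to \<open>A / c\<close>.\<close>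

lemma (in prob_space) selection_deviation:
  fixes f g :: "'z \<Rightarrow> real" and \<phi> :: "real \<Rightarrow> real" and p :: real
  assumes n: "n \<ge> 1"
    and indep: "indep_vars (\<lambda>_. Z) \<xi> {1..n}"
    and distr: "\<And>i. i \<in> {1..n} \<Longrightarrow> distr M Z (\<xi> i) = P"
    and f[measurable]: "f \<in> borel_measurable Z" and g[measurable]: "g \<in> borel_measurable Z"
    and f1: "\<And>z. z \<in> space Z \<Longrightarrow> \<bar>f z\<bar> \<le> 1" and g1: "\<And>z. z \<in> space Z \<Longrightarrow> \<bar>g z\<bar> \<le> 1"
    and fg: "\<And>z. z \<in> space Z \<Longrightarrow> \<bar>f z - g z\<bar> \<le> 1"
    and mono: "mono_on {0<..} (\<lambda>x. \<phi> x / x\<^sup>2)" and zero: "\<phi> 0 = 0"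
    and conj: "\<And>x. x \<ge> 0 \<Longrightarrow> x * (1 / sqrt (real n)) - \<phi> x \<le> p"
    and rf: "norm2 P f \<le> rf" "\<phi> rf = (\<integral>z. f z \<partial>P)"
    and rg: "norm2 P g \<le> rg" "\<phi> rg = (\<integral>z. g z \<partial>P)"
    and \<epsilon>: "0 < \<epsilon>" "\<epsilon> < 1" and c: "c \<ge> 2"
    and A: "A = 4 / \<epsilon> * p + 1 / (3 * real n)"
  shows "expectation (\<lambda>\<omega>. max 0 ((\<integral>z. f z \<partial>P) - (\<integral>z. g z \<partial>P)
             - (empirical_mean n (\<lambda>i. \<xi> i \<omega>) f - empirical_mean n (\<lambda>i. \<xi> i \<omega>) g)
             - \<epsilon> * ((\<integral>z. f z \<partial>P) + (\<integral>z. g z \<partial>P)) - A * ln c)) \<le> A / c"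
    (is "expectation (\<lambda>\<omega>. max 0 (?Q \<omega>)) \<le> _")
proof -
  have \<xi>[measurable]: "i \<in> {1..n} \<Longrightarrow> \<xi> i \<in> measurable M Z" for i
    using indep by (auto simp: indep_vars_def)
  have P: "P = distr M Z (\<xi> 1)" using distr[of 1] n by simp
  interpret P: prob_space P unfolding P using n by (intro prob_space_distr \<xi>) auto
  have setsP[measurable_cong]: "sets P = sets Z" and spP: "space P = space Z" by (auto simp: P)
  define Lf Lg where "Lf = (\<integral>z. f z \<partial>P)" and "Lg = (\<integral>z. g z \<partial>P)"
  \<comment> \<open>With this sign, an upper deviation of the sum of the \<open>V i\<close> is an
    excess of the true over the empirical difference of losses.\<close>
  define V where "V i \<omega> = - (f (\<xi> i \<omega>) - g (\<xi> i \<omega>))" for i \<omega>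
  define s where "s = rf + rg"
  have rf0: "rf \<ge> 0" and rg0: "rg \<ge> 0"
    using rf(1) rg(1) by (auto simp: norm2_def intro: order_trans[rotated])
  have p0: "p \<ge> 0" using conj[of 0] zero by simp
  \<comment> \<open>The summand \<open>1 / (3 * real n)\<close> keeps \<open>A\<close> positive even
    when \<open>p = 0\<close>, so that \<open>t / A\<close> is meaningful.\<close>
  have A0: "A > 0" using p0 \<epsilon> n by (auto simp: A intro!: add_nonneg_pos)
  have intf: "integrable P f" and intg: "integrable P g"
    using f1 g1 by (auto intro!: P.integrable_const_bound[of _ 1] simp: spP)
  have EV: "expectation (V i) = Lg - Lf" if i: "i \<in> {1..n}" for i
  proof -
    have "expectation (V i) = (\<integral>z. - (f z - g z) \<partial>P)"
      unfolding V_def distr[OF i, symmetric] using i by (intro integral_distr[symmetric]) auto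
    then show ?thesis using intf intg by (simp add: Lf_def Lg_def)
  qed
  have EV2: "expectation (\<lambda>\<omega>. (V i \<omega>)\<^sup>2) \<le> s\<^sup>2" if i: "i \<in> {1..n}" for i
  proof -
    have "expectation (\<lambda>\<omega>. (V i \<omega>)\<^sup>2) = (\<integral>z. (- (f z - g z))\<^sup>2 \<partial>P)"
      unfolding V_def distr[OF i, symmetric] using i by (intro integral_distr[symmetric]) auto
    also have "\<dots> = (norm2 P (\<lambda>z. f z - g z))\<^sup>2"
      by (simp add: norm2_def power2_commute)
    also have "\<dots> \<le> (norm2 P f + norm2 P g)\<^sup>2"
      using f1 g1
      by (intro power_mono norm2_diff_le)
        (auto intro!: P.integrable_const_bound[of _ 1] simp: spP abs_square_le_1 norm2_def)
    also have "\<dots> \<le> s\<^sup>2"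
      unfolding s_def by (intro power_mono add_mono rf rg) (auto simp: norm2_def)
    finally show ?thesis .
  qed
  have indepV: "indep_vars (\<lambda>_. borel) V {1..n}"
    unfolding V_def by (rule indep_vars_compose2[OF indep]) auto
  have [measurable]: "V i \<in> borel_measurable M" if "i \<in> {1..n}" for i
    using indepV that by (auto simp: indep_vars_def)
  have Vb: "\<bar>V i \<omega>\<bar> \<le> 1" if "i \<in> {1..n}" "\<omega> \<in> space M" for i \<omega>
    using fg[OF measurable_space[OF \<xi>[OF that(1)] that(2)]] by (simp add: V_def)
  have em[measurable]: "(\<lambda>\<omega>. empirical_mean n (\<lambda>i. \<xi> i \<omega>) f) \<in> borel_measurable M"
    "(\<lambda>\<omega>. empirical_mean n (\<lambda>i. \<xi> i \<omega>) g) \<in> borel_measurable M"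
    unfolding empirical_mean_def by (auto intro!: borel_measurable_sum borel_measurable_times)
  have emV: "real n * (empirical_mean n (\<lambda>i. \<xi> i \<omega>) f - empirical_mean n (\<lambda>i. \<xi> i \<omega>) g) = - (\<Sum>i=1..n. V i \<omega>)" for \<omega>
    using n by (simp add: empirical_mean_def V_def sum_subtractf sum_negf field_simps)
  have sumV: "(\<Sum>i=1..n. V i \<omega> - expectation (V i))
     = real n * (Lf - Lg - (empirical_mean n (\<lambda>i. \<xi> i \<omega>) f - empirical_mean n (\<lambda>i. \<xi> i \<omega>) g))" for \<omega>
    using emV[of \<omega>] by (simp add: EV sum_subtractf sum.distrib algebra_simps)
  define Q where "Q = ?Q"
  have [measurable]: "Q \<in> borel_measurable M" unfolding Q_def by measurable
  have intQ: "integrable M Q"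
  proof -
    have "\<bar>empirical_mean n (\<lambda>i. \<xi> i \<omega>) f - empirical_mean n (\<lambda>i. \<xi> i \<omega>) g\<bar> \<le> 1" if \<omega>: "\<omega> \<in> space M" for \<omega>
    proof -
      have "real n * \<bar>empirical_mean n (\<lambda>i. \<xi> i \<omega>) f - empirical_mean n (\<lambda>i. \<xi> i \<omega>) g\<bar> = \<bar>\<Sum>i=1..n. V i \<omega>\<bar>"
        using emV[of \<omega>] by (metis abs_minus_cancel abs_mult abs_of_nat)
      also have "\<dots> \<le> (\<Sum>i=1..n. 1)"
        using Vb \<omega> by (intro order_trans[OF sum_abs] sum_mono) auto
      finally show ?thesis using n by simp
    qed
    then have "integrable M (\<lambda>\<omega>. empirical_mean n (\<lambda>i. \<xi> i \<omega>) f - empirical_mean n (\<lambda>i. \<xi> i \<omega>) g)"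
      by (intro integrable_const_bound[of _ 1]) auto
    then show ?thesis unfolding Q_def by auto
  qed
  have tail: "prob {\<omega>\<in>space M. Q \<omega> > t} \<le> 1 / c * exp (- t / A)" if t: "t \<ge> 0" for t
  proof -
    \<comment> \<open>With this level, \<open>exp (- y)\<close> is \<open>exp (- t / A) / c\<close>
      and \<open>A * y\<close> is \<open>A * ln c + t\<close>.\<close>
    define y where "y = ln c + t / A"
    \<comment> \<open>This yields \<open>2 * y \<ge> 1\<close>, hence
      \<open>\<epsilon> \<le> sqrt (2 * y)\<close>, so the scale \<open>a\<close> below is at least
      one, as the scaled Young inequality demands.\<close>
    have "exp (1 / 2) \<le> c" using exp_half_le2 c by linarith
    then have "1 / 2 \<le> ln c" using c by (subst ln_ge_iff) auto
    moreover have "t / A \<ge> 0" using t A0 by simp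
    ultimately have y: "2 * y \<ge> 1" by (simp add: y_def)
    \<comment> \<open>The scale is fitted so that \<open>n * \<epsilon> * s * a / sqrt n\<close> is
      the Bernstein term \<open>s * sqrt (2 * y * n)\<close>. The price of two applications of
      Young's inequality, \<open>2 * \<epsilon> * a\<^sup>2 * p\<close>, is then
      \<open>y * (4 / \<epsilon> * p)\<close>, the origin of the constant
      \<open>4 / \<epsilon>\<close>.\<close>
    define a where "a = sqrt (2 * y) / \<epsilon>"
    have a2: "a\<^sup>2 = 2 * y / \<epsilon>\<^sup>2" using y by (simp add: a_def power_divide)
    have "\<epsilon> \<le> sqrt (2 * y)" using \<epsilon> y by (intro real_le_rsqrt) (smt (verit) power_le_one)
    then have a: "a \<ge> 1" using \<epsilon> by (simp add: a_def)
    have "s * a * (1 / sqrt (real n)) \<le> Lf + Lg + 2 * (a\<^sup>2 * p)"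
      using scaled_young_ineq[OF mono zero conj a rf0] scaled_young_ineq[OF mono zero conj a rg0] rf rg
      by (simp add: s_def Lf_def Lg_def algebra_simps add_divide_distrib)
    then have "\<epsilon> * (s * a * (1 / sqrt (real n))) \<le> \<epsilon> * (Lf + Lg + 2 * (a\<^sup>2 * p))"
      using \<epsilon> by (intro mult_left_mono) auto
    also have "\<epsilon> * (Lf + Lg + 2 * (a\<^sup>2 * p)) = \<epsilon> * (Lf + Lg) + y * (4 / \<epsilon> * p)"
      unfolding a2 using \<epsilon> by (simp add: power2_eq_square field_simps)
    finally have "real n * (\<epsilon> * (s * a * (1 / sqrt (real n)))) \<le> real n * (\<epsilon> * (Lf + Lg) + y * (4 / \<epsilon> * p))"
      by (intro mult_left_mono) auto
    moreover have "real n * (\<epsilon> * (s * a * (1 / sqrt (real n)))) = s * sqrt (2 * y * n)"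
    proof -
      have "real n = sqrt (real n) * sqrt (real n)" by simp
      then have "real n * (1 / sqrt (real n)) = sqrt (real n)" using n by (simp add: real_div_sqrt)
      then show ?thesis using \<epsilon> by (simp add: a_def real_sqrt_mult) (metis mult.commute mult.left_commute times_divide_eq_right mult_1_right)
    qed
    ultimately have dev: "s * sqrt (2 * y * n) + y / 3 \<le> real n * (\<epsilon> * (Lf + Lg) + y * A)"
      using n by (simp add: A algebra_simps)
    have "{\<omega>\<in>space M. Q \<omega> > t}
       \<subseteq> {\<omega>\<in>space M. (\<Sum>i=1..n. V i \<omega> - expectation (V i)) > s * sqrt (2 * y * real (card {1..n})) + y / 3}"
    proof safe
      fix \<omega> assume "t < Q \<omega>"
      moreover have "A * y = A * ln c + t" using A0 by (simp add: y_def algebra_simps)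
      ultimately have "\<epsilon> * (Lf + Lg) + y * A
         < Lf - Lg - (empirical_mean n (\<lambda>i. \<xi> i \<omega>) f - empirical_mean n (\<lambda>i. \<xi> i \<omega>) g)"
        by (simp add: Q_def Lf_def Lg_def mult.commute)
      then have "real n * (\<epsilon> * (Lf + Lg) + y * A) < (\<Sum>i=1..n. V i \<omega> - expectation (V i))"
        unfolding sumV using n by (intro mult_strict_left_mono) auto
      with dev show "(\<Sum>i=1..n. V i \<omega> - expectation (V i)) > s * sqrt (2 * y * real (card {1..n})) + y / 3"
        by simp
    qed
    then have "prob {\<omega>\<in>space M. Q \<omega> > t} \<le>
        prob {\<omega>\<in>space M. (\<Sum>i=1..n. V i \<omega> - expectation (V i)) > s * sqrt (2 * y * real (card {1..n})) + y / 3}"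
      by (intro finite_measure_mono) measurable
    also have "\<dots> \<le> exp (- y)"
      using y rf0 rg0 by (intro bernstein_tail indepV Vb EV2) (auto simp: s_def)
    also have "exp (- y) = 1 / c * exp (- t / A)"
      using c by (simp add: y_def exp_diff exp_minus inverse_eq_divide mult.commute)
    finally show ?thesis .
  qed
  show ?thesis
    using expectation_pos_part_le_of_exp_tail[OF intQ A0 _ tail] c by (simp add: Q_def)
qed

theorem mainTheorem2:
  fixes \<Omega> :: "'w measure"
    and S :: "'s measure" and T :: "real set"
    and X :: "'w \<Rightarrow> 's" and Y :: "'w \<Rightarrow> real"
    and Z P :: "('s \<times> real) measure"
    and l :: "real \<Rightarrow> real \<Rightarrow> real"
    and G :: "('s \<Rightarrow> real) set" and gs :: "'s \<Rightarrow> real"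
    and N n :: nat
    and \<xi>' \<xi> :: "nat \<Rightarrow> 'w \<Rightarrow> 's \<times> real"
    and \<M> :: "'m set"
    and ghat :: "'m \<Rightarrow> (nat \<Rightarrow> 's \<times> real) \<Rightarrow> 's \<Rightarrow> real"
    and mhat :: "'w \<Rightarrow> 'm"
    and \<phi> :: "real \<Rightarrow> real"
  assumes "prob_space \<Omega>"
    and "T \<in> sets borel"
    and "X \<in> measurable \<Omega> S"
    and "Y \<in> measurable \<Omega> (restrict_space borel T)"
    and Z_eq: "Z = S \<Otimes>\<^sub>M restrict_space borel T"
    and P_eq: "P = distr \<Omega> Z (\<lambda>\<omega>. (X \<omega>, Y \<omega>))"
    and "(\<lambda>(y, u). l y u) \<in> borel_measurable (restrict_space borel T \<Otimes>\<^sub>M borel)"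
    and "\<And>y u. y \<in> T \<Longrightarrow> l y u \<in> {0..1}"
    and "G \<subseteq> borel_measurable S"
    and "gs \<in> G"
    and "\<And>g. g \<in> G \<Longrightarrow> (\<integral>\<omega>. l (Y \<omega>) (gs (X \<omega>)) \<partial>\<Omega>) \<le> (\<integral>\<omega>. l (Y \<omega>) (g (X \<omega>)) \<partial>\<Omega>)"
    and "n \<ge> 1"
    and "prob_space.indep_vars \<Omega> (\<lambda>_. Z) (case_sum \<xi>' \<xi>) ({1..N} <+> {1..n})"
    and "\<And>i. i \<in> {1..N} \<Longrightarrow> distr \<Omega> Z (\<xi>' i) = P"
    and "\<And>i. i \<in> {1..n} \<Longrightarrow> distr \<Omega> Z (\<xi> i) = P"
    and "finite \<M>" and "card \<M> \<ge> 2"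
    and "\<And>m z. m \<in> \<M> \<Longrightarrow> z \<in> space (sample_space N Z) \<Longrightarrow> ghat m z \<in> G"
    and "\<And>m. m \<in> \<M> \<Longrightarrow> (\<lambda>(z, x). ghat m z x) \<in> borel_measurable (sample_space N Z \<Otimes>\<^sub>M S)"
    and "mhat \<in> measurable \<Omega> (count_space \<M>)"
    and "AE \<omega> in \<Omega>. \<forall>m\<in>\<M>.
           empirical_mean n (\<lambda>i. \<xi> i \<omega>) (loss_comp l (ghat (mhat \<omega>) (sample N \<xi>' \<omega>)))
         \<le> empirical_mean n (\<lambda>i. \<xi> i \<omega>) (loss_comp l (ghat m (sample N \<xi>' \<omega>)))"
    and "convex_on {0..} \<phi>"
    and "strict_mono_on {0..} \<phi>"
    and "bij_betw \<phi> {0..} {0..}"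
    and "\<phi> 0 = 0"
    and "mono_on {0<..} (\<lambda>x. \<phi> x / x\<^sup>2)"
    and "\<And>\<eta>. \<eta> \<ge> 0 \<Longrightarrow>
           (SUP g\<in>{g\<in>G. excess_risk \<Omega> X Y l g gs \<le> \<eta>}.
              norm2 P (\<lambda>z. loss_comp l g z - loss_comp l gs z))
           \<le> inv_into {0..} \<phi> \<eta>"
  shows "\<forall>\<epsilon>\<in>{0<..<1::real}. AE \<omega> in \<Omega>.
      ereal (real_cond_exp \<Omega> (vimage_algebra (space \<Omega>) (sample N \<xi>') (sample_space N Z))
               (\<lambda>\<omega>. excess_risk \<Omega> X Y l (ghat (mhat \<omega>) (sample N \<xi>' \<omega>)) gs) \<omega>)
      \<le> ereal ((1 + \<epsilon>) / (1 - \<epsilon>) * (INF m\<in>\<M>. excess_risk \<Omega> X Y l (ghat m (sample N \<xi>' \<omega>)) gs))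
        + ereal (1 / (1 - \<epsilon>) * ln (exp 1 * real (card \<M>)))
          * (ereal (4 / \<epsilon>) * convex_conjugate \<phi> (1 / sqrt (real n)) + ereal (1 / (3 * real n)))"
proof
  fix \<epsilon> :: real assume "\<epsilon> \<in> {0<..<1}"
  then have \<epsilon>: "0 < \<epsilon>" "\<epsilon> < 1" by auto
  note prob = assms(1) and X[measurable] = assms(3) and Y[measurable] = assms(4)
    and l = assms(7) and l01 = assms(8) and G = assms(9) and gs = assms(10) and gsmin = assms(11)
    and n = assms(12) and indep = assms(13) and distr = assms(15)
    and finM = assms(16) and cardM = assms(17) and ghatG = assms(18) and ghat = assms(19)
    and mhat = assms(20) and mhatmin = assms(21) and bij = assms(24)
    and zero = assms(25) and mono = assms(26) and norm = assms(27)
  interpret \<Omega>: prob_space \<Omega> by (rule prob)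
  let ?SS = "sample_space N Z"
  let ?S = "sample N \<xi>'"
  let ?FF = "sample_space n Z"
  let ?T = "sample n \<xi>"
  let ?c = "real (card \<M>)"
  let ?conj = "convex_conjugate \<phi> (1 / sqrt (real n))"
  define b where "b = 1 / sqrt (real n)"
  define L where "L m z = excess_risk \<Omega> X Y l (ghat m z) gs" for m z
  define d where "d g = (\<lambda>w. loss_comp l g w - loss_comp l gs w)" for g

  \<comment> \<open>Losses, excess risks and the norm condition\<close>
  have XY[measurable]: "(\<lambda>\<omega>. (X \<omega>, Y \<omega>)) \<in> measurable \<Omega> Z"
    unfolding Z_eq by measurable
  interpret P: prob_space P unfolding P_eq by (rule \<Omega>.prob_space_distr) simp
  have setsP[measurable_cong]: "sets P = sets Z" and spP: "space P = space Z" by (auto simp: P_eq)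
  have loss01: "loss_comp l g w \<in> {0..1}" if "w \<in> space Z" for g w
    using that l01 by (auto simp: loss_comp_def Z_eq space_pair_measure space_restrict_space split: prod.splits)
  have XYsp: "(X \<omega>, Y \<omega>) \<in> space Z" if "\<omega> \<in> space \<Omega>" for \<omega>
    using measurable_space[OF XY that] .
  have loss_meas: "(\<lambda>w. loss_comp l g w) \<in> borel_measurable Z" if "g \<in> G" for g
  proof -
    have [measurable]: "g \<in> borel_measurable S" using that G by auto
    have "(\<lambda>w. (snd w, g (fst w))) \<in> measurable Z (restrict_space borel T \<Otimes>\<^sub>M borel)"
      unfolding Z_eq by measurable
    from measurable_compose[OF this l] show ?thesis
      by (simp add: loss_comp_def split_beta')
  qed
  have d_meas: "d g \<in> borel_measurable Z" if "g \<in> G" for g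
    unfolding d_def using loss_meas[OF that] loss_meas[OF gs] by measurable
  have d1: "\<bar>d g w\<bar> \<le> 1" if "w \<in> space Z" for g w
    using loss01[OF that, of g] loss01[OF that, of gs] by (auto simp: d_def)
  have risk: "excess_risk \<Omega> X Y l g gs = (\<integral>w. d g w \<partial>P)" if "g \<in> G" for g
    unfolding excess_risk_def P_eq using d_meas[OF that] by (subst integral_distr) (auto simp: d_def)
  have loss_int: "integrable \<Omega> (\<lambda>\<omega>. l (Y \<omega>) (g (X \<omega>)))" if "g \<in> G" for g
  proof (rule \<Omega>.integrable_const_bound[of _ 1])
    show "AE \<omega> in \<Omega>. norm (l (Y \<omega>) (g (X \<omega>))) \<le> 1"
      using loss01[OF XYsp, of _ g] by (intro AE_I2) (auto simp: loss_comp_def)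
    show "(\<lambda>\<omega>. l (Y \<omega>) (g (X \<omega>))) \<in> borel_measurable \<Omega>"
      using measurable_compose[OF XY loss_meas[OF that]] by (simp add: loss_comp_def)
  qed
  have risk0: "excess_risk \<Omega> X Y l g gs \<ge> 0" if "g \<in> G" for g
    using gsmin[OF that] loss_int[OF that] loss_int[OF gs]
    by (simp add: excess_risk_def loss_comp_def)
  have risk1: "excess_risk \<Omega> X Y l g gs \<le> 1" if "g \<in> G" for g
  proof -
    have "(\<integral>w. d g w \<partial>P) \<le> (\<integral>w. 1 \<partial>P)"
      using d_meas[OF that] d1 by (intro integral_mono P.integrable_const_bound[of _ 1]) (auto simp: spP abs_le_iff)
    then show ?thesis using risk[OF that] by (simp add: P.prob_space)
  qed
  \<comment> \<open>A supremum of reals is known to dominate its members only when they are bounded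
    above; this crude bound supplies that for the norm hypothesis.\<close>
  have norm1: "norm2 P (d g) \<le> 1" if "g \<in> G" for g
  proof -
    have "(\<integral>w. (d g w)\<^sup>2 \<partial>P) \<le> (\<integral>w. 1 \<partial>P)"
      using d_meas[OF that] d1
      by (intro integral_mono P.integrable_const_bound[of _ 1]) (auto simp: spP abs_square_le_1)
    then show ?thesis by (simp add: norm2_def P.prob_space)
  qed
  \<comment> \<open>The norm hypothesis at \<open>\<eta>\<close> equal to the risk of
    \<open>g\<close> itself bounds the norm of \<open>d g\<close> by \<open>r g\<close>, and
    surjectivity of \<open>\<phi>\<close> recovers the risk as \<open>\<phi> (r g)\<close>.\<close>
  define r where "r g = inv_into {0..} \<phi> (excess_risk \<Omega> X Y l g gs)" for g
  have r: "norm2 P (d g) \<le> r g" "\<phi> (r g) = (\<integral>w. d g w \<partial>P)" if g: "g \<in> G" for g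
  proof -
    let ?\<eta> = "excess_risk \<Omega> X Y l g gs"
    have "norm2 P (d g) \<le> (SUP g\<in>{g\<in>G. excess_risk \<Omega> X Y l g gs \<le> ?\<eta>}. norm2 P (d g))"
      using g norm1 by (intro cSUP_upper bdd_aboveI2[where M=1]) auto
    also have "\<dots> \<le> r g"
      unfolding r_def d_def using g by (intro norm risk0)
    finally show "norm2 P (d g) \<le> r g" .
    show "\<phi> (r g) = (\<integral>w. d g w \<partial>P)"
      unfolding r_def risk[OF g, symmetric] using risk0[OF g] bij
      by (intro f_inv_into_f) (auto simp: bij_betw_def)
  qed

  \<comment> \<open>Independence within the hold-out sample and between the two samples\<close>
  have indep\<xi>: "\<Omega>.indep_vars (\<lambda>_. Z) \<xi> {1..n}"
  proof -
    \<comment> \<open>The hold-out variables are extracted from the combined family by restricting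
      it to the singletons \<open>{Inr j}\<close> and evaluating at the only index.\<close>
    have "\<Omega>.indep_vars (\<lambda>j. PiM {Inr j} (\<lambda>_. Z)) (\<lambda>j \<omega>. \<lambda>i\<in>{Inr j}. case_sum \<xi>' \<xi> i \<omega>) {1..n}"
      by (rule \<Omega>.indep_vars_restrict[OF indep]) (auto simp: disjoint_family_on_def)
    then have "\<Omega>.indep_vars (\<lambda>_. Z) (\<lambda>j \<omega>. (\<lambda>x. x (Inr j)) (\<lambda>i\<in>{Inr j}. case_sum \<xi>' \<xi> i \<omega>)) {1..n}"
      by (rule \<Omega>.indep_vars_compose2) (auto intro!: measurable_component_singleton)
    then show ?thesis by simp
  qed
  have indepST: "\<Omega>.indep_var ?SS ?S ?FF ?T"
  proof -
    \<comment> \<open>Two disjoint blocks of the combined family are independent vectors indexed by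
      the sum type; reindexing turns them into the two samples.\<close>
    have "\<Omega>.indep_var (PiM (Inl ` {1..N}) (\<lambda>_. Z)) (\<lambda>\<omega>. \<lambda>i\<in>Inl ` {1..N}. case_sum \<xi>' \<xi> i \<omega>)
        (PiM (Inr ` {1..n}) (\<lambda>_. Z)) (\<lambda>\<omega>. \<lambda>i\<in>Inr ` {1..n}. case_sum \<xi>' \<xi> i \<omega>)"
      by (rule \<Omega>.indep_var_restrict[OF indep]) auto
    then have "\<Omega>.indep_var ?SS ((\<lambda>x. \<lambda>i\<in>{1..N}. x (Inl i)) \<circ> (\<lambda>\<omega>. \<lambda>i\<in>Inl ` {1..N}. case_sum \<xi>' \<xi> i \<omega>))
        ?FF ((\<lambda>x. \<lambda>i\<in>{1..n}. x (Inr i)) \<circ> (\<lambda>\<omega>. \<lambda>i\<in>Inr ` {1..n}. case_sum \<xi>' \<xi> i \<omega>))"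
      unfolding sample_space_def
      by (rule \<Omega>.indep_var_compose) (auto intro!: measurable_restrict measurable_component_singleton)
    moreover have "(\<lambda>x. \<lambda>i\<in>{1..N}. x (Inl i)) \<circ> (\<lambda>\<omega>. \<lambda>i\<in>Inl ` {1..N}. case_sum \<xi>' \<xi> i \<omega>) = ?S"
      by (auto simp: sample_def fun_eq_iff)
    moreover have "(\<lambda>x. \<lambda>i\<in>{1..n}. x (Inr i)) \<circ> (\<lambda>\<omega>. \<lambda>i\<in>Inr ` {1..n}. case_sum \<xi>' \<xi> i \<omega>) = ?T"
      by (auto simp: sample_def fun_eq_iff)
    ultimately show ?thesis by simp
  qed
  then have S[measurable]: "?S \<in> measurable \<Omega> ?SS" and T[measurable]: "?T \<in> measurable \<Omega> ?FF"
    by (auto simp: \<Omega>.indep_var_distribution_eq)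
  have S_sp: "?S \<omega> \<in> space ?SS" if "\<omega> \<in> space \<Omega>" for \<omega>
    using measurable_space[OF S that] .
  have T_sp: "?T \<omega> i \<in> space Z" if "\<omega> \<in> space \<Omega>" "i \<in> {1..n}" for \<omega> i
    using measurable_space[OF T that(1)] that(2) by (auto simp: sample_space_def space_PiM)

  \<comment> \<open>Joint measurability and bounds for losses and risks\<close>
  have loss_joint: "(\<lambda>(z, w). loss_comp l (ghat m z) w) \<in> borel_measurable (?SS \<Otimes>\<^sub>M Z)" if m: "m \<in> \<M>" for m
  proof -
    have "(\<lambda>q. (fst q, fst (snd q))) \<in> measurable (?SS \<Otimes>\<^sub>M Z) (?SS \<Otimes>\<^sub>M S)"
      unfolding Z_eq by measurable
    from measurable_compose[OF this ghat[OF m]]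
    have [measurable]: "(\<lambda>q. ghat m (fst q) (fst (snd q))) \<in> borel_measurable (?SS \<Otimes>\<^sub>M Z)"
      by simp
    have "(\<lambda>q. (snd (snd q), ghat m (fst q) (fst (snd q)))) \<in> measurable (?SS \<Otimes>\<^sub>M Z) (restrict_space borel T \<Otimes>\<^sub>M borel)"
    proof (rule measurable_Pair)
      show "(\<lambda>q. snd (snd q)) \<in> measurable (?SS \<Otimes>\<^sub>M Z) (restrict_space borel T)"
        unfolding Z_eq by measurable
    qed simp
    from measurable_compose[OF this l] show ?thesis
      by (simp add: loss_comp_def split_beta')
  qed
  have emp_joint: "(\<lambda>q. empirical_mean n (snd q) (loss_comp l (ghat m (fst q)))) \<in> borel_measurable (?SS \<Otimes>\<^sub>M ?FF)"
    if m: "m \<in> \<M>" for m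
  proof -
    have "(\<lambda>q. loss_comp l (ghat m (fst q)) (snd q i)) \<in> borel_measurable (?SS \<Otimes>\<^sub>M ?FF)" if i: "i \<in> {1..n}" for i
    proof -
      have "(\<lambda>q. (fst q, snd q i)) \<in> measurable (?SS \<Otimes>\<^sub>M ?FF) (?SS \<Otimes>\<^sub>M Z)"
        unfolding sample_space_def using i
        by (intro measurable_Pair measurable_fst measurable_compose[OF measurable_snd measurable_component_singleton])
      from measurable_compose[OF this loss_joint[OF m]] show ?thesis by simp
    qed
    then show ?thesis
      unfolding empirical_mean_def by (intro borel_measurable_times borel_measurable_sum) auto
  qed
  have L_meas: "L m \<in> borel_measurable ?SS" if m: "m \<in> \<M>" for m
  proof -
    have "(\<lambda>q. (fst q, (X (snd q), Y (snd q)))) \<in> measurable (?SS \<Otimes>\<^sub>M \<Omega>) (?SS \<Otimes>\<^sub>M Z)"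
      by measurable
    from measurable_compose[OF this loss_joint[OF m]]
    have [measurable]: "(\<lambda>(z, \<omega>). loss_comp l (ghat m z) (X \<omega>, Y \<omega>)) \<in> borel_measurable (?SS \<Otimes>\<^sub>M \<Omega>)"
      by (simp add: split_beta')
    have [measurable]: "(\<lambda>\<omega>. loss_comp l gs (X \<omega>, Y \<omega>)) \<in> borel_measurable \<Omega>"
      using measurable_compose[OF XY loss_meas[OF gs]] .
    show ?thesis
      unfolding L_def excess_risk_def by measurable
  qed
  have L01: "L m z \<in> {0..1}" if "m \<in> \<M>" "z \<in> space ?SS" for m z
    using risk0[OF ghatG[OF that]] risk1[OF ghatG[OF that]] by (simp add: L_def)
  have emp01: "empirical_mean n (?T \<omega>) (loss_comp l g) \<in> {0..1}" if "\<omega> \<in> space \<Omega>" for \<omega> g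
  proof -
    have "(\<Sum>i=1..n. loss_comp l g (?T \<omega> i)) \<le> (\<Sum>i=1..n. 1)"
      using loss01[OF T_sp[OF that]] by (intro sum_mono) auto
    moreover have "0 \<le> (\<Sum>i=1..n. loss_comp l g (?T \<omega> i))"
      using loss01[OF T_sp[OF that]] by (intro sum_nonneg) auto
    ultimately show ?thesis using n by (simp add: empirical_mean_def field_simps)
  qed
  have emp_T: "empirical_mean n (\<lambda>i. \<xi> i \<omega>) f = empirical_mean n (?T \<omega>) f" for \<omega> f
    by (simp add: empirical_mean_def sample_def)

  define F where "F \<omega> = L (mhat \<omega>) (?S \<omega>)" for \<omega>
  have mhatM: "mhat \<omega> \<in> \<M>" if "\<omega> \<in> space \<Omega>" for \<omega>
    using measurable_space[OF mhat that] by simp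
  have intF: "integrable \<Omega> F"
  proof (rule \<Omega>.integrable_const_bound[of _ 1])
    show "AE \<omega> in \<Omega>. norm (F \<omega>) \<le> 1"
      using L01[OF mhatM S_sp] by (intro AE_I2) (auto simp: F_def)
    show "F \<in> borel_measurable \<Omega>"
      unfolding F_def
      \<comment> \<open>The random index takes finitely many values, so measurability reduces to
        that of each \<open>L m\<close>.\<close>
      by (rule measurable_compose_countable'[where f="\<lambda>m \<omega>. L m (?S \<omega>)", OF _ mhat countable_finite[OF finM]])
        (rule measurable_compose[OF S L_meas])
  qed

  \<comment> \<open>Conditional bound against one fixed competitor\<close>
  let ?cond = "real_cond_exp \<Omega> (vimage_algebra (space \<Omega>) ?S ?SS) F"
  \<comment> \<open>The conjugate may be infinite, so the bound is stated for any real
    \<open>p\<close> above all the values \<open>x * b - \<phi> x\<close>.\<close>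
  have bound: "AE \<omega> in \<Omega>. ?cond \<omega> \<le> (1 + \<epsilon>) / (1 - \<epsilon>) * L k (?S \<omega>) + 1 / (1 - \<epsilon>) * ln (exp 1 * ?c) * A"
    if k: "k \<in> \<M>" and conj: "\<And>x. x \<ge> 0 \<Longrightarrow> x * b - \<phi> x \<le> p" and A: "A = 4 / \<epsilon> * p + 1 / (3 * real n)" for k p A
  proof -
    define emp where "emp m q = empirical_mean n (snd q) (loss_comp l (ghat m (fst q)))" for m and q :: "(nat \<Rightarrow> 's \<times> real) \<times> (nat \<Rightarrow> 's \<times> real)"
    define D where "D m q = L m (fst q) - L k (fst q) - (emp m q - emp k q)
        - \<epsilon> * (L m (fst q) + L k (fst q)) - A * ln ?c" for m q
    \<comment> \<open>Summing the positive parts over all \<open>m\<close> dominates the deviation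
      at the data-dependent index \<open>mhat\<close>, with no union bound beyond the factor
      \<open>card \<M>\<close>.\<close>
    define W where "W q = (\<Sum>m\<in>\<M>. max 0 (D m q)) / (1 - \<epsilon>)" for q
    define R where "R z = ((1 + \<epsilon>) * L k z + A * ln ?c) / (1 - \<epsilon>)" for z
    have c: "?c \<ge> 2" using cardM by simp
    have D_meas: "D m \<in> borel_measurable (?SS \<Otimes>\<^sub>M ?FF)" if m: "m \<in> \<M>" for m
      using measurable_compose[OF measurable_fst L_meas[OF m]] measurable_compose[OF measurable_fst L_meas[OF k]]
        emp_joint[OF m] emp_joint[OF k]
      unfolding D_def emp_def by measurable
    have W_meas: "W \<in> borel_measurable (?SS \<Otimes>\<^sub>M ?FF)"
      unfolding W_def using D_meas by (intro borel_measurable_divide borel_measurable_sum borel_measurable_max) auto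
    \<comment> \<open>The map \<open>z\<close> covers both uses: the random training sample and a
      frozen constant.\<close>
    have D_int: "integrable \<Omega> (\<lambda>\<omega>. max 0 (D m (z \<omega>, ?T \<omega>)))"
      if m: "m \<in> \<M>" and z[measurable]: "z \<in> measurable \<Omega> ?SS" for m z
    proof -
      have sp: "z \<omega> \<in> space ?SS" if "\<omega> \<in> space \<Omega>" for \<omega>
        using measurable_space[OF z that] .
      have [measurable]: "(\<lambda>\<omega>. D m (z \<omega>, ?T \<omega>)) \<in> borel_measurable \<Omega>"
        by (rule measurable_compose[OF _ D_meas[OF m]]) measurable
      \<comment> \<open>The differences of risks and of empirical means contribute at most 1 each,
        and the \<open>\<epsilon>\<close> term at most 2.\<close>
      have "\<bar>D m (z \<omega>, ?T \<omega>)\<bar> \<le> 4 + \<bar>A * ln ?c\<bar>" if \<omega>: "\<omega> \<in> space \<Omega>" for \<omega>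
      proof -
        have "0 \<le> L m (z \<omega>) + L k (z \<omega>)" "L m (z \<omega>) + L k (z \<omega>) \<le> 2"
          using L01[OF m sp[OF \<omega>]] L01[OF k sp[OF \<omega>]] by auto
        then have "\<epsilon> * (L m (z \<omega>) + L k (z \<omega>)) \<le> 1 * 2" "\<epsilon> * (L m (z \<omega>) + L k (z \<omega>)) \<ge> 0"
          using \<epsilon> by (intro mult_mono mult_nonneg_nonneg; simp)+
        then show ?thesis
          using L01[OF m sp[OF \<omega>]] L01[OF k sp[OF \<omega>]] emp01[OF \<omega>, of "ghat m (z \<omega>)"] emp01[OF \<omega>, of "ghat k (z \<omega>)"]
          unfolding D_def emp_def fst_conv snd_conv atLeastAtMost_iff by linarith
      qed
      then have "integrable \<Omega> (\<lambda>\<omega>. D m (z \<omega>, ?T \<omega>))"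
        by (intro \<Omega>.integrable_const_bound[of _ "4 + \<bar>A * ln ?c\<bar>"]) auto
      then show ?thesis by auto
    qed
    have W_int: "integrable \<Omega> (\<lambda>\<omega>. W (?S \<omega>, ?T \<omega>))"
      unfolding W_def using D_int S by auto
    have W_le: "(\<integral>\<omega>. W (z, ?T \<omega>) \<partial>\<Omega>) \<le> A / (1 - \<epsilon>)" if z: "z \<in> space ?SS" for z
    proof -
      have "(\<integral>\<omega>. max 0 (D m (z, ?T \<omega>)) \<partial>\<Omega>) \<le> A / ?c" if m: "m \<in> \<M>" for m
      proof -
        note gm = ghatG[OF m z] and gk = ghatG[OF k z]
        \<comment> \<open>The loss of \<open>gs\<close> cancels, so the difference of excess losses
          has range \<open>[-1, 1]\<close> and not \<open>[-2, 2]\<close>.\<close>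
        have "\<bar>d (ghat m z) w - d (ghat k z) w\<bar> \<le> 1" if "w \<in> space Z" for w
          using loss01[OF that, of "ghat m z"] loss01[OF that, of "ghat k z"] by (auto simp: d_def)
        from \<Omega>.selection_deviation[OF n indep\<xi> distr d_meas[OF gm] d_meas[OF gk] d1 d1 this mono zero
            conj[unfolded b_def] r[OF gm] r[OF gk] \<epsilon> c A]
        have "(\<integral>\<omega>. max 0 ((\<integral>w. d (ghat m z) w \<partial>P) - (\<integral>w. d (ghat k z) w \<partial>P)
             - (empirical_mean n (\<lambda>i. \<xi> i \<omega>) (d (ghat m z)) - empirical_mean n (\<lambda>i. \<xi> i \<omega>) (d (ghat k z)))
             - \<epsilon> * ((\<integral>w. d (ghat m z) w \<partial>P) + (\<integral>w. d (ghat k z) w \<partial>P)) - A * ln ?c) \<partial>\<Omega>) \<le> A / ?c"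
          by simp
        moreover have "empirical_mean n (\<lambda>i. \<xi> i \<omega>) (d (ghat m z)) - empirical_mean n (\<lambda>i. \<xi> i \<omega>) (d (ghat k z))
            = emp m (z, ?T \<omega>) - emp k (z, ?T \<omega>)" for \<omega>
          unfolding emp_T by (simp add: emp_def empirical_mean_def d_def sum_subtractf algebra_simps)
        moreover have "L m z = (\<integral>w. d (ghat m z) w \<partial>P)" "L k z = (\<integral>w. d (ghat k z) w \<partial>P)"
          unfolding L_def using risk gm gk by auto
        ultimately show ?thesis by (simp add: D_def)
      qed
      \<comment> \<open>The \<open>card \<M>\<close> deviations of expectation at most
        \<open>A / ?c\<close> cost one \<open>A\<close> in total; added to \<open>A * ln ?c\<close>,
        it produces \<open>A * ln (exp 1 * ?c)\<close>.\<close>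
      then have "(\<Sum>m\<in>\<M>. \<integral>\<omega>. max 0 (D m (z, ?T \<omega>)) \<partial>\<Omega>) \<le> (\<Sum>m\<in>\<M>. A / ?c)"
        by (rule sum_mono)
      also have "\<dots> = A" using c by simp
      finally have "(\<integral>\<omega>. (\<Sum>m\<in>\<M>. max 0 (D m (z, ?T \<omega>))) \<partial>\<Omega>) \<le> A"
        using D_int[OF _ measurable_const[OF z]] by (subst Bochner_Integration.integral_sum) auto
      then show ?thesis
        unfolding W_def using \<epsilon> by (simp add: divide_right_mono)
    qed
    have R_meas: "R \<in> borel_measurable ?SS"
      unfolding R_def using L_meas[OF k] by measurable
    have R_int: "integrable \<Omega> (\<lambda>\<omega>. R (?S \<omega>))"
    proof -
      have "integrable \<Omega> (\<lambda>\<omega>. L k (?S \<omega>))"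
        using L01[OF k S_sp] measurable_compose[OF S L_meas[OF k]]
        by (intro \<Omega>.integrable_const_bound[of _ 1]) auto
      then show ?thesis unfolding R_def by auto
    qed
    have F_le: "AE \<omega> in \<Omega>. F \<omega> \<le> R (?S \<omega>) + W (?S \<omega>, ?T \<omega>)"
      using mhatmin AE_space
    proof eventually_elim
      case (elim \<omega>)
      let ?q = "(?S \<omega>, ?T \<omega>)"
      have m: "mhat \<omega> \<in> \<M>" using elim mhatM by auto
      have "emp (mhat \<omega>) ?q \<le> emp k ?q"
        using elim(1) k by (simp add: emp_def emp_T)
      \<comment> \<open>The definition of \<open>D\<close> is solved for the selected risk, and the
        empirical difference is dropped because it is nonpositive by the choice of
        \<open>mhat\<close>.\<close>
      then have "(1 - \<epsilon>) * F \<omega> \<le> (1 + \<epsilon>) * L k (?S \<omega>) + A * ln ?c + D (mhat \<omega>) ?q"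
        by (simp add: D_def F_def algebra_simps)
      also have "D (mhat \<omega>) ?q \<le> max 0 (D (mhat \<omega>) ?q)" by simp
      also have "\<dots> \<le> (\<Sum>m\<in>\<M>. max 0 (D m ?q))"
        using m finM by (intro member_le_sum) auto
      finally have "F \<omega> \<le> ((1 + \<epsilon>) * L k (?S \<omega>) + A * ln ?c + (\<Sum>m\<in>\<M>. max 0 (D m ?q))) / (1 - \<epsilon>)"
        using \<epsilon> by (simp add: field_simps)
      then show ?case by (simp add: R_def W_def add_divide_distrib)
    qed
    have "R z + A / (1 - \<epsilon>) = (1 + \<epsilon>) / (1 - \<epsilon>) * L k z + 1 / (1 - \<epsilon>) * ln (exp 1 * ?c) * A" for z
      using \<epsilon> c by (simp add: R_def ln_mult divide_simps) (simp add: algebra_simps)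
    with \<Omega>.real_cond_exp_le_of_indep_var[OF indepST W_meas W_int W_le R_meas R_int intF F_le]
    show ?thesis by simp
  qed

  \<comment> \<open>From one competitor to the infimum, with a possibly infinite conjugate\<close>
  have conj_ge: "ereal (x * b - \<phi> x) \<le> ?conj" if "x \<ge> 0" for x
    unfolding convex_conjugate_def b_def using that by (intro SUP_upper) auto
  have conj0: "?conj \<ge> 0" using conj_ge[of 0] zero by (simp add: zero_ereal_def)
  have K0: "1 / (1 - \<epsilon>) * ln (exp 1 * ?c) > 0"
    using \<epsilon> cardM by (simp add: ln_mult add_pos_nonneg)
  show "AE \<omega> in \<Omega>.
      ereal (real_cond_exp \<Omega> (vimage_algebra (space \<Omega>) (sample N \<xi>') (sample_space N Z))
               (\<lambda>\<omega>. excess_risk \<Omega> X Y l (ghat (mhat \<omega>) (sample N \<xi>' \<omega>)) gs) \<omega>)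
      \<le> ereal ((1 + \<epsilon>) / (1 - \<epsilon>) * (INF m\<in>\<M>. excess_risk \<Omega> X Y l (ghat m (sample N \<xi>' \<omega>)) gs))
        + ereal (1 / (1 - \<epsilon>) * ln (exp 1 * real (card \<M>)))
          * (ereal (4 / \<epsilon>) * convex_conjugate \<phi> (1 / sqrt (real n)) + ereal (1 / (3 * real n)))"
  proof (cases ?conj)
    \<comment> \<open>Both factors in front of the conjugate are positive, so the right-hand side is
      infinite and the claim is trivial.\<close>
    case PInf
    then show ?thesis
      using K0 \<epsilon> by auto
  next
    case MInf
    then show ?thesis using conj0 by simp
  next
    case (real p)
    have conj: "x * b - \<phi> x \<le> p" if "x \<ge> 0" for x
      using conj_ge[OF that] real by simp
    have "AE \<omega> in \<Omega>. \<forall>k\<in>\<M>. ?cond \<omega> \<le> (1 + \<epsilon>) / (1 - \<epsilon>) * L k (?S \<omega>)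
        + 1 / (1 - \<epsilon>) * ln (exp 1 * ?c) * (4 / \<epsilon> * p + 1 / (3 * real n))"
      by (intro AE_finite_allI finM) (rule bound[OF _ conj refl])
    then show ?thesis
    proof eventually_elim
      case (elim \<omega>)
      \<comment> \<open>Finiteness of \<open>\<M>\<close> gives one null set for all competitors and
        makes the infimum attained at some \<open>k\<close>, which may depend on
        \<open>\<omega>\<close>.\<close>
      have "\<M> \<noteq> {}" using cardM by auto
      then have "(INF m\<in>\<M>. L m (?S \<omega>)) \<in> (\<lambda>m. L m (?S \<omega>)) ` \<M>"
        using finM by (simp add: cInf_eq_Min)
      then obtain k where "k \<in> \<M>" "(INF m\<in>\<M>. L m (?S \<omega>)) = L k (?S \<omega>)" by auto
      with elim have "?cond \<omega> \<le> (1 + \<epsilon>) / (1 - \<epsilon>) * (INF m\<in>\<M>. L m (?S \<omega>))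
        + 1 / (1 - \<epsilon>) * ln (exp 1 * ?c) * (4 / \<epsilon> * p + 1 / (3 * real n))" by simp
      then show ?case
        unfolding real L_def F_def by simp
    qed
  qed
qed

end
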